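(* Let $A \in M_2(\mathbb{R})$ be a real $2 \times 2$ matrix such that $\det(A) = 1$. Then $$\sum_{k=1}^{9} A^k = (\operatorname{tr}(A) + 1)\,(\operatorname{tr}(A^3) + 1)\, A^5.$$
   Context: $\operatorname{tr}$ denotes the trace of a matrix. *)

theory Defs
  imports "HOL-Analysis.Analysis"
begin

(* The type class power on vec is componentwise, so A ^ k is not the matrix power. *)
primrec matpow :: "'a::semiring_1^'n^'n \<Rightarrow> nat \<Rightarrow> 'a^'n^'n" where
  "matpow A 0 = mat 1"
| "matpow A (Suc k) = A ** matpow A k"

end

theory Submission
  imports Defs
begin

text \<open>
  By Cayley--Hamilton, \<open>A\<^sup>k\<^sup>+\<^sup>2 = tr(A) A\<^sup>k\<^sup>+\<^sup>1 - A\<^sup>k\<close> when \<open>det A = 1\<close>. Hence every entry of \<open>A\<^sup>k\<close>,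
  and likewise the trace of \<open>A\<^sup>k\<close>, is a linear recurrent sequence in \<open>k\<close>, and the claim becomes a
  polynomial identity in \<open>tr(A)\<close> and the first two terms of the sequence.
\<close>

lemma Cayley_Hamilton_2:
  fixes A :: "real^2^2"
  shows "A ** A = trace A *\<^sub>R A - det A *\<^sub>R mat 1"
  by (simp add: vec_eq_iff forall_2 matrix_matrix_mult_def trace_def det_2 mat_def UNIV_2
      algebra_simps)

lemma matpow_Suc_Suc:
  fixes A :: "real^2^2"
  shows "matpow A (Suc (Suc k)) = trace A *\<^sub>R matpow A (Suc k) - det A *\<^sub>R matpow A k"
proof -
  have "matpow A (Suc (Suc k)) = (A ** A) ** matpow A k"
    by (simp add: matrix_mul_assoc)
  also have "\<dots> = trace A *\<^sub>R matpow A (Suc k) - det A *\<^sub>R matpow A k"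
    unfolding Cayley_Hamilton_2
    by (simp add: vec_eq_iff matrix_matrix_mult_def mat_def forall_2 sum_2 algebra_simps)
  finally show ?thesis .
qed

text \<open>Symmetry about index 5: \<open>p (5 + j) + p (5 - j) = T_j * p 5\<close> with
  \<open>T_1 = t\<close>, \<open>T_3 = t^3 - 3 * t\<close> and \<open>T_1 * T_3 = T_2 + T_4\<close>,
  so the sum is \<open>(1 + T_1) * (1 + T_3) * p 5\<close>. The proof checks this by expanding in
  \<open>p 0\<close> and \<open>p 1\<close>.\<close>

lemma sum_linear_recurrence:
  fixes p :: "nat \<Rightarrow> 'a::comm_ring_1"
  assumes "\<And>k. p (Suc (Suc k)) = t * p (Suc k) - p k"
  shows "(\<Sum>k=1..9. p k) = (t + 1) * (t ^ 3 - 3 * t + 1) * p 5"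
proof -
  have p: "p 2 = t * p 1 - p 0" "p 3 = t * p 2 - p 1" "p 4 = t * p 3 - p 2" "p 5 = t * p 4 - p 3"
    "p 6 = t * p 5 - p 4" "p 7 = t * p 6 - p 5" "p 8 = t * p 7 - p 6" "p 9 = t * p 8 - p 7"
    using assms[of 0] assms[of 1] assms[of 2] assms[of 3] assms[of 4] assms[of 5]
      assms[of 6] assms[of 7] by (simp_all add: eval_nat_numeral)
  have "(\<Sum>k=1..9. p k) = p 1 + p 2 + p 3 + p 4 + p 5 + p 6 + p 7 + p 8 + p 9"
    by (simp add: numeral_eq_Suc)
  also have "\<dots> = (t + 1) * (t ^ 3 - 3 * t + 1) * p 5"
    unfolding p by (simp add: algebra_simps power3_eq_cube)
  finally show ?thesis .
qed

text \<open>Identifies the cubic factor of \<open>sum_linear_recurrence\<close>: traces of powers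
  obey the same recurrence, starting from 2 and \<open>trace A\<close>.\<close>

lemma trace_matpow_3:
  fixes A :: "real^2^2"
  assumes "det A = 1"
  shows "trace (matpow A 3) = trace A ^ 3 - 3 * trace A"
proof -
  have *: "trace (c *\<^sub>R X - Y) = c * trace X - trace Y" for c and X Y :: "real^2^2"
    by (simp add: trace_def sum_2 algebra_simps)
  have "trace (matpow A 3) = trace A * (trace A * trace A - trace (mat 1 :: real^2^2)) - trace A"
    \<comment> \<open>Without \<open>matpow.simps(2)\<close>, powers reduce by the recurrence and do
      not unfold into products.\<close>
    by (simp add: numeral_3_eq_3 matpow_Suc_Suc assms * del: matpow.simps(2))
       (simp add: matrix_mul_rid)
  then show ?thesis
    by (simp add: trace_def sum_2 mat_def algebra_simps power3_eq_cube)
qed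

theorem theorem6p1:
  fixes A :: "real^2^2"
  assumes "det A = 1"
  shows "(\<Sum>k=1..9. matpow A k)
    = ((trace A + 1) * (trace (matpow A 3) + 1)) *\<^sub>R matpow A 5"
proof -
  have "(\<Sum>k=1..9. matpow A k $ i $ j)
      = (trace A + 1) * (trace A ^ 3 - 3 * trace A + 1) * matpow A 5 $ i $ j" for i j
    by (rule sum_linear_recurrence) (simp add: matpow_Suc_Suc assms del: matpow.simps(2))
  then show ?thesis
    by (simp add: vec_eq_iff sum_component trace_matpow_3[OF assms])
qed

end
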